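(* Let $(X,f_{1,\infty})$ be a minimal non-autonomous discrete system with $f_{1,\infty}$ feeble open and surjective and converging uniformly to a map $f$. Suppose that $\{f_n^{n+k}\}_{k\in\mathbb{N}}$ converges collectively to $\{f^k\}_{k\in\mathbb{N}}$. If $(X,f_{1,\infty})$ is multi-transitive, then $(X,f_{1,\infty})$ is Li-Yorke chaotic.
   Context: $\mathbb{N}=\{1,2,3,\dots\}$. A non-autonomous discrete system $(X,f_{1,\infty})$ consists of a compact metric space $(X,d)$ and a sequence $f_{1,\infty}=\{f_n\}_{n=1}^\infty$ of continuous maps $f_n:X\to X$. For $i,n\in\mathbb{N}$, $f_i^n:=f_{i+(n-1)}\circ\cdots\circ f_i$ (a composition of $n$ maps), and $f_i^0=id_X$. Uniform convergence of $f_{1,\infty}$ to $f:X\to X$ means $D(f_n,f)\to 0$, where $D(g,h)=\sup_{x\in X}d(g(x),h(x))$. "$\{f_n^{n+k}\}_{k\in\mathbb{N}}$ converges collectively to $\{f^k\}_{k\in\mathbb{N}}$" means: for every $\varepsilon>0$ there exists $r_0\in\mathbb{N}$ such that $D(f_r^k,f^k)<\varepsilon$ for all $r\ge r_0$ and all $k\in\mathbb{N}$, where $f_r^k=f_{r+k-1}\circ\cdots\circ f_r$ and $f^k$ is the $k$-fold composition of $f$. $f_{1,\infty}$ is surjective if every $f_i$ is surjective. It is feeble open if $\mathrm{int}(f_i(U))\neq\emptyset$ for every nonempty open $U\subseteq X$ and every $i\in\mathbb{N}$. The system is minimal if for every $x\in X$ the orbit $\{x,f_1^1(x),f_1^2(x),\dots\}$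 is dense in $X$. $f_{1,\infty}$ is multi-transitive if for every $m\in\mathbb{N}$ and every collection of nonempty open subsets $U_1,\dots,U_m,V_1,\dots,V_m$ of $X$ there exists $l\in\mathbb{N}$ such that $f_1^{jl}(U_j)\cap V_j\neq\emptyset$ for each $j\in\{1,\dots,m\}$. $f_{1,\infty}$ is Li-Yorke chaotic if there is an uncountable set $S\subseteq X$ such that for any two different points $x,y\in S$, $\liminf_{n\to\infty}d(f_1^n(x),f_1^n(y))=0$ and $\limsup_{n\to\infty}d(f_1^n(x),f_1^n(y))>0$.
   Formalization: The space X is assumed to have at least two points; on a one-point space with identity maps all hypotheses hold but no uncountable scrambled set exists. *)

theory Defs
  imports "HOL-Analysis.Analysis"
begin

text \<open>
  The space is the whole of a metric type, whose topology is the one induced by \<open>dist\<close>.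
  A sequence of maps indexed by 1, 2, 3, ... is represented by a function on \<open>nat\<close>
  whose value at 0 is never constrained and never used.
\<close>

definition nds :: "(nat \<Rightarrow> 'a::metric_space \<Rightarrow> 'a) \<Rightarrow> bool" where
  "nds F \<longleftrightarrow> compact (UNIV :: 'a set) \<and> (\<forall>i\<ge>1. continuous_on UNIV (F i))"

text \<open>\<open>nds_iter F i n\<close> is the composition of the \<open>n\<close> maps \<open>F (i + n - 1) \<circ> \<dots> \<circ> F i\<close>.\<close>

primrec nds_iter :: "(nat \<Rightarrow> 'a \<Rightarrow> 'a) \<Rightarrow> nat \<Rightarrow> nat \<Rightarrow> 'a \<Rightarrow> 'a" where
  "nds_iter F i 0 = id"
| "nds_iter F i (Suc n) = F (i + n) \<circ> nds_iter F i n"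

text \<open>
  The supremum is taken in \<open>real\<close>; it is the intended one whenever the space is compact,
  since all distances are then bounded.
\<close>

definition sup_dist :: "('a \<Rightarrow> 'a::metric_space) \<Rightarrow> ('a \<Rightarrow> 'a) \<Rightarrow> real" where
  "sup_dist g h = (SUP x. dist (g x) (h x))"

definition converges_uniformly ::
    "(nat \<Rightarrow> 'a::metric_space \<Rightarrow> 'a) \<Rightarrow> ('a \<Rightarrow> 'a) \<Rightarrow> bool" where
  "converges_uniformly F f \<longleftrightarrow> (\<lambda>n. sup_dist (F n) f) \<longlonglongrightarrow> 0"

definition converges_collectively ::
    "(nat \<Rightarrow> 'a::metric_space \<Rightarrow> 'a) \<Rightarrow> ('a \<Rightarrow> 'a) \<Rightarrow> bool" where
  "converges_collectively F f \<longleftrightarrow>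
     (\<forall>\<epsilon>>0. \<exists>r0\<ge>1. \<forall>r\<ge>r0. \<forall>k\<ge>1. sup_dist (nds_iter F r k) (f ^^ k) < \<epsilon>)"

definition nds_surjective :: "(nat \<Rightarrow> 'a \<Rightarrow> 'a) \<Rightarrow> bool" where
  "nds_surjective F \<longleftrightarrow> (\<forall>i\<ge>1. surj (F i))"

definition feeble_open :: "(nat \<Rightarrow> 'a::metric_space \<Rightarrow> 'a) \<Rightarrow> bool" where
  "feeble_open F \<longleftrightarrow> (\<forall>i\<ge>1. \<forall>U. open U \<and> U \<noteq> {} \<longrightarrow> interior (F i ` U) \<noteq> {})"

definition nds_minimal :: "(nat \<Rightarrow> 'a::metric_space \<Rightarrow> 'a) \<Rightarrow> bool" where
  "nds_minimal F \<longleftrightarrow> (\<forall>x. closure (range (\<lambda>n. nds_iter F 1 n x)) = UNIV)"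

definition multi_transitive :: "(nat \<Rightarrow> 'a::metric_space \<Rightarrow> 'a) \<Rightarrow> bool" where
  "multi_transitive F \<longleftrightarrow>
     (\<forall>m\<ge>1. \<forall>U V :: nat \<Rightarrow> 'a set.
        (\<forall>j\<in>{1..m}. open (U j) \<and> U j \<noteq> {} \<and> open (V j) \<and> V j \<noteq> {}) \<longrightarrow>
        (\<exists>l\<ge>1. \<forall>j\<in>{1..m}. nds_iter F 1 (j * l) ` U j \<inter> V j \<noteq> {}))"

text \<open>Distances are embedded in \<open>ereal\<close> because \<open>liminf\<close> and \<open>limsup\<close> live in complete lattices.\<close>

definition li_yorke_chaotic :: "(nat \<Rightarrow> 'a::metric_space \<Rightarrow> 'a) \<Rightarrow> bool" where
  "li_yorke_chaotic F \<longleftrightarrow>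
     (\<exists>S :: 'a set. uncountable S \<and>
        (\<forall>x\<in>S. \<forall>y\<in>S. x \<noteq> y \<longrightarrow>
           liminf (\<lambda>n. ereal (dist (nds_iter F 1 n x) (nds_iter F 1 n y))) = 0 \<and>
           limsup (\<lambda>n. ereal (dist (nds_iter F 1 n x) (nds_iter F 1 n y))) > 0))"

end

theory Submission
  imports Defs
begin

text \<open>
  Multi-transitivity passes to the limit map \<open>f\<close> in the following shifted form: for small balls \<open>P\<close>, \<open>Q\<close>
  and a number \<open>r\<close> depending only on the radius there is an \<open>a\<close> such that both \<open>f\<^sup>a(P) \<inter> P\<close> and
  \<open>f\<^sup>2\<^sup>a\<^sup>+\<^sup>r(P) \<inter> Q\<close> are nonempty. If the iterates of \<open>f\<close> keep an open set small with respect to some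
  continuous pseudometric, this puts every \<open>Q\<close> close to the single point \<open>f\<^sup>r(p)\<close>, so that the
  pseudometric is small on the whole space. Applied to the metric itself this shows that there are no
  isolated points, hence that \<open>f\<close> is minimal, and that \<open>f\<close> is sensitive.

  Suppose that the orbits of two open sets \<open>U\<close>, \<open>V\<close> under \<open>f\<close> stay apart by \<open>\<epsilon>\<close>, and let \<open>K\<close> be the closed
  invariant set of pairs whose orbits stay apart by \<open>\<epsilon>\<close>. For an \<open>f\<close>-invariant mean \<open>\<mu>\<close> the measure of the
  section \<open>K\<^sub>x\<close> is upper semicontinuous and nondecreasing along orbits, so it is constant by minimality, and
  \<open>\<mu>(K\<^sub>x \<union> K\<^sub>y) - \<mu>(K\<^sub>x)\<close> is a nontrivial continuous \<open>f\<close>-invariant pseudometric, which contradicts the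
  above. Hence proximal pairs are dense.

  Collective convergence and feeble openness transfer both density statements to the system itself, and
  the uncountable scrambled set comes from Baire's theorem and Zorn's lemma.
\<close>

section \<open>Invariant means and invariant pseudometrics\<close>

text \<open>Krylov-Bogolyubov averaging along one orbit: pulling back by \<open>f\<close> changes a
  visit frequency by at most \<open>1 / Suc N\<close>, so a cluster point is exactly invariant.
  Finite additivity lets the mean be defined on every subset.\<close>

lemma ex_invariant_mean:
  fixes f :: "'a \<Rightarrow> 'a"
  shows "\<exists>\<mu> :: 'a set \<Rightarrow> real. (\<forall>A. 0 \<le> \<mu> A) \<and> \<mu> {} = 0 \<and> \<mu> UNIV = 1 \<and>
    (\<forall>A B. \<mu> (A \<union> B) + \<mu> (A \<inter> B) = \<mu> A + \<mu> B) \<and> (\<forall>A. \<mu> (f -` A) = \<mu> A)"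
proof -
  define z :: 'a where "z = undefined"
  define m :: "nat \<Rightarrow> 'a set \<Rightarrow> real"
    where "m N A = (\<Sum>k<Suc N. indicator A ((f ^^ k) z)) / real (Suc N)" for N A
  have m_bounds: "0 \<le> m N A" "m N A \<le> 1" for N A
  proof -
    show "0 \<le> m N A"
      unfolding m_def by (intro divide_nonneg_nonneg sum_nonneg) auto
    have "(\<Sum>k<Suc N. indicator A ((f ^^ k) z) :: real) \<le> (\<Sum>k<Suc N. 1)"
      by (intro sum_mono) (auto simp: indicator_def)
    then show "m N A \<le> 1"
      unfolding m_def by (simp del: sum.lessThan_Suc)
  qed
  \<comment> \<open>A cluster point of the visit frequencies, by Tychonoff; it replaces a Banach limit.\<close>
  define C :: "('a set \<Rightarrow> real) set" where "C = (\<Pi>\<^sub>E A\<in>UNIV. {0..1})"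
  have "compactin (product_topology (\<lambda>_. euclidean) UNIV) C"
    unfolding C_def by (subst compactin_PiE) auto
  then have "compact C"
    by (simp add: euclidean_product_topology)
  moreover have "filtermap m sequentially \<noteq> bot"
    by (simp add: filtermap_bot_iff)
  moreover have "eventually (\<lambda>g. g \<in> C) (filtermap m sequentially)"
    using m_bounds by (auto simp: eventually_filtermap C_def PiE_def)
  ultimately obtain \<mu> where \<mu>: "\<mu> \<in> C"
    and cluster: "inf (nhds \<mu>) (filtermap m sequentially) \<noteq> bot"
    unfolding compact_filter by blast
  \<comment> \<open>Each identity for \<open>\<mu>\<close> below is the vanishing of a continuous
    function of finitely many coordinates that tends to 0 along \<open>m\<close>.\<close>
  have limit: "\<phi> \<mu> = 0"
    if "continuous_on UNIV \<phi>" "(\<lambda>N. \<phi> (m N)) \<longlonglongrightarrow> 0" for \<phi> :: "('a set \<Rightarrow> real) \<Rightarrow> real"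
  proof -
    let ?H = "inf (nhds \<mu>) (filtermap m sequentially)"
    have "(\<phi> \<longlongrightarrow> \<phi> \<mu>) (nhds \<mu>)"
      using that(1) by (simp add: continuous_on_def tendsto_at_iff_tendsto_nhds)
    then have "(\<phi> \<longlongrightarrow> \<phi> \<mu>) ?H"
      by (rule tendsto_mono[rotated]) simp
    moreover have "(\<phi> \<longlongrightarrow> 0) (filtermap m sequentially)"
      using that(2) by (simp add: filterlim_filtermap)
    then have "(\<phi> \<longlongrightarrow> 0) ?H"
      by (rule tendsto_mono[rotated]) simp
    ultimately show ?thesis
      using tendsto_unique[OF cluster] by blast
  qed
  note cont = continuous_on_product_coordinates
  have nonneg: "0 \<le> \<mu> A" for A
    using \<mu> by (auto simp: C_def PiE_def Pi_def)
  have total: "\<mu> UNIV = 1"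
  proof -
    have "\<mu> UNIV - 1 = 0"
      by (rule limit) (auto intro!: continuous_intros cont simp: m_def)
    then show ?thesis by simp
  qed
  have empty: "\<mu> {} = 0"
    by (rule limit) (auto intro!: cont simp: m_def)
  have modular: "\<mu> (A \<union> B) + \<mu> (A \<inter> B) = \<mu> A + \<mu> B" for A B
  proof -
    have "m N (A \<union> B) + m N (A \<inter> B) = m N A + m N B" for N
      unfolding m_def add_divide_distrib[symmetric] sum.distrib[symmetric]
      by (intro arg_cong2[where f = "(/)"] sum.cong) (auto simp: indicator_def)
    then have "\<mu> (A \<union> B) + \<mu> (A \<inter> B) - (\<mu> A + \<mu> B) = 0"
      by (intro limit continuous_intros cont) simp
    then show ?thesis by simp
  qed
  have invariant: "\<mu> (f -` A) = \<mu> A" for A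
  proof -
    have shift: "indicator (f -` A) ((f ^^ k) z) = (indicator A ((f ^^ Suc k) z) :: real)" for k
      by (auto simp: indicator_def)
    \<comment> \<open>The difference telescopes and leaves only the two ends of the orbit
      segment.\<close>
    have "m N (f -` A) - m N A =
        ((\<Sum>k<Suc N. indicator A ((f ^^ Suc k) z) - indicator A ((f ^^ k) z)) / real (Suc N))" for N
      unfolding m_def shift sum_subtractf diff_divide_distrib ..
    then have diff: "m N (f -` A) - m N A =
        (indicator A ((f ^^ Suc N) z) - indicator A z) / real (Suc N)" for N
      unfolding sum_lessThan_telescope[of "\<lambda>k. indicator A ((f ^^ k) z)"] by simp
    have "norm (m N (f -` A) - m N A) \<le> 1 / real (Suc N)" for N
      unfolding diff by (auto simp: indicator_def field_simps)
    then have "(\<lambda>N. m N (f -` A) - m N A) \<longlonglongrightarrow> 0"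
      by (intro Lim_null_comparison[OF _ lim_1_over_n[THEN LIMSEQ_Suc]]) auto
    then have "\<mu> (f -` A) - \<mu> A = 0"
      by (intro limit continuous_intros cont)
    then show ?thesis by simp
  qed
  show ?thesis
    using nonneg empty total modular invariant by blast
qed

section \<open>Continuous pseudometrics and semicontinuity of sections\<close>

text \<open>Continuity is required near the diagonal only; the triangle inequality spreads it. The
  clauses also force \<open>\<rho> x x = 0\<close> and hence, by symmetry, nonnegativity.\<close>

definition continuous_pseudometric :: "('a::metric_space \<Rightarrow> 'a \<Rightarrow> real) \<Rightarrow> bool" where
  "continuous_pseudometric \<rho> \<longleftrightarrow>
     (\<forall>x y. \<rho> x y = \<rho> y x) \<and> (\<forall>x y z. \<rho> x z \<le> \<rho> x y + \<rho> y z) \<and>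
     (\<forall>e>0. \<exists>d>0. \<forall>x y. dist x y < d \<longrightarrow> \<rho> x y < e)"

lemma continuous_pseudometric_dist: "continuous_pseudometric dist"
  unfolding continuous_pseudometric_def by (auto simp: dist_commute dist_triangle)

text \<open>By compactness the orbit of the pair \<open>(x, y)\<close> comes close to itself at two
  times. Expansion pulls this back, so both points nearly return at a common time
  \<open>p > 0\<close>, and \<open>\<rho> (f x) (f y)\<close> is at most the distance at time
  \<open>p\<close>.\<close>

lemma expanding_imp_isometric:
  fixes f :: "'a::metric_space \<Rightarrow> 'a"
  assumes "compact (UNIV :: 'a set)" and \<rho>: "continuous_pseudometric \<rho>"
    and expand: "\<And>x y. \<rho> x y \<le> \<rho> (f x) (f y)"
  shows "\<rho> (f x) (f y) = \<rho> x y"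
proof (rule antisym[OF field_le_epsilon expand])
  fix e :: real
  assume "e > 0"
  then obtain d where "d > 0" and d: "\<And>x y. dist x y < d \<Longrightarrow> \<rho> x y < e / 2"
    using \<rho> unfolding continuous_pseudometric_def by (metis half_gt_zero)
  have sym: "\<rho> a b = \<rho> b a" and tri: "\<rho> a c \<le> \<rho> a b + \<rho> b c" for a b c
    using \<rho> unfolding continuous_pseudometric_def by blast+
  have iter: "\<rho> a b \<le> \<rho> ((f ^^ n) a) ((f ^^ n) b)" for n a b
    by (induction n) (auto intro: order_trans[OF _ expand])
  have "compact (UNIV :: ('a \<times> 'a) set)"
    using compact_Times[OF assms(1) assms(1)] by simp
  then obtain l and r :: "nat \<Rightarrow> nat" where "strict_mono r"
    and lim: "((\<lambda>n. ((f ^^ n) x, (f ^^ n) y)) \<circ> r) \<longlonglongrightarrow> l"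
    unfolding compact_def by (metis UNIV_I)
  from LIMSEQ_imp_Cauchy[OF lim] obtain M
    where M: "\<And>m n. m \<ge> M \<Longrightarrow> n \<ge> M \<Longrightarrow>
      dist ((f ^^ r m) x, (f ^^ r m) y) ((f ^^ r n) x, (f ^^ r n) y) < d"
    unfolding Cauchy_def comp_def using \<open>d > 0\<close> by blast
  define p where "p = r (Suc M) - r M"
  have "r M < r (Suc M)"
    using \<open>strict_mono r\<close> by (simp add: strict_mono_Suc_iff)
  then have "p > 0" and "r (Suc M) = r M + p"
    by (auto simp: p_def)
  have "\<rho> x ((f ^^ p) x) < e / 2"
  proof -
    have "\<rho> x ((f ^^ p) x) \<le> \<rho> ((f ^^ r M) x) ((f ^^ r (Suc M)) x)"
      using iter[of x "(f ^^ p) x" "r M"] by (simp add: \<open>r (Suc M) = _\<close> funpow_add)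
    also have "\<dots> < e / 2"
      using M[of M "Suc M"] by (intro d le_less_trans[OF dist_fst_le[of "((f ^^ r M) x, (f ^^ r M) y)" "((f ^^ r (Suc M)) x, (f ^^ r (Suc M)) y)", unfolded fst_conv snd_conv]]) simp
    finally show ?thesis .
  qed
  have "\<rho> y ((f ^^ p) y) < e / 2"
  proof -
    have "\<rho> y ((f ^^ p) y) \<le> \<rho> ((f ^^ r M) y) ((f ^^ r (Suc M)) y)"
      using iter[of y "(f ^^ p) y" "r M"] by (simp add: \<open>r (Suc M) = _\<close> funpow_add)
    also have "\<dots> < e / 2"
      using M[of M "Suc M"] by (intro d le_less_trans[OF dist_snd_le[of "((f ^^ r M) x, (f ^^ r M) y)" "((f ^^ r (Suc M)) x, (f ^^ r (Suc M)) y)", unfolded fst_conv snd_conv]]) simp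
    finally show ?thesis .
  qed
  \<comment> \<open>After the first step \<open>p - 1\<close> more remain, which is where
    \<open>p > 0\<close> enters.\<close>
  have "\<rho> (f x) (f y) \<le> \<rho> ((f ^^ p) x) ((f ^^ p) y)"
    using iter[of "f x" "f y" "p - 1"] \<open>p > 0\<close> by (cases p) (simp_all add: funpow_swap1)
  also have "\<dots> \<le> \<rho> x y + e"
    using tri[of "(f ^^ p) x" "(f ^^ p) y" x] tri[of x "(f ^^ p) y" y]
      \<open>\<rho> x ((f ^^ p) x) < e / 2\<close> \<open>\<rho> y ((f ^^ p) y) < e / 2\<close>
      sym[of x "(f ^^ p) x"] sym[of y "(f ^^ p) y"] by linarith
  finally show "\<rho> (f x) (f y) \<le> \<rho> x y + e" .
qed

text \<open>Upper semicontinuity of sections: the complement is the projection of the compact set of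
  pairs in \<open>K\<close> with second coordinate outside \<open>U\<close>.\<close>

lemma open_section_subset:
  fixes K :: "('a::metric_space \<times> 'a) set"
  assumes "compact (UNIV :: 'a set)" "closed K" "open U"
  shows "open {x. K `` {x} \<subseteq> U}"
proof -
  have "compact (UNIV :: ('a \<times> 'a) set)"
    using compact_Times[OF assms(1) assms(1)] by simp
  moreover have "closed (K \<inter> UNIV \<times> (- U))"
    using assms by (intro closed_Int closed_Times) auto
  ultimately have "compact (K \<inter> UNIV \<times> (- U))"
    using compact_Int_closed by fastforce
  then have "compact (fst ` (K \<inter> UNIV \<times> (- U)))"
    by (intro compact_continuous_image continuous_intros)
  then have "closed (fst ` (K \<inter> UNIV \<times> (- U)))"
    by (rule compact_imp_closed)
  moreover have "fst ` (K \<inter> UNIV \<times> (- U)) = - {x. K `` {x} \<subseteq> U}"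
    by force
  ultimately show ?thesis
    by (simp add: closed_def)
qed

lemma continuous_on_funpow:
  "continuous_on UNIV f \<Longrightarrow> continuous_on UNIV (f ^^ n)" for f :: "'a::topological_space \<Rightarrow> 'a"
  by (induction n) (auto intro: continuous_on_compose2[of UNIV f] continuous_on_id simp: id_def comp_def)

text \<open>The size of the union of two sections beyond their common size measures how much the
  sections differ. Minimality enters as the absence of proper nonempty closed forward invariant
  sets.\<close>

lemma ex_invariant_pseudometric:
  fixes f :: "'a::metric_space \<Rightarrow> 'a"
  assumes cpt: "compact (UNIV :: 'a set)" and cont: "continuous_on UNIV f"
    and min: "\<And>C. closed C \<Longrightarrow> C \<noteq> {} \<Longrightarrow> f ` C \<subseteq> C \<Longrightarrow> C = UNIV"
    and U: "open U" "U \<noteq> {}" and V: "open V" "V \<noteq> {}" and "\<epsilon> > 0"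
    and apart: "\<And>u v n. u \<in> U \<Longrightarrow> v \<in> V \<Longrightarrow> \<epsilon> \<le> dist ((f ^^ n) u) ((f ^^ n) v)"
  shows "\<exists>\<rho>. continuous_pseudometric \<rho> \<and> (\<forall>x y. \<rho> (f x) (f y) = \<rho> x y) \<and> (\<exists>x y. \<rho> x y > 0)"
proof -
  obtain \<mu> :: "'a set \<Rightarrow> real" where nonneg: "\<And>A. 0 \<le> \<mu> A"
    and empty: "\<mu> {} = 0" and total: "\<mu> UNIV = 1"
    and modular: "\<And>A B. \<mu> (A \<union> B) + \<mu> (A \<inter> B) = \<mu> A + \<mu> B"
    and invariant: "\<And>A. \<mu> (f -` A) = \<mu> A"
    using ex_invariant_mean[of f] by blast
  have disjoint: "\<mu> (A \<union> B) = \<mu> A + \<mu> B" if "A \<inter> B = {}" for A B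
    using modular[of A B] that empty by simp
  have mono: "\<mu> A \<le> \<mu> B" if "A \<subseteq> B" for A B
    using disjoint[of A "B - A"] nonneg[of "B - A"] that by (simp add: Un_absorb1)
  \<comment> \<open>Points that never visit \<open>B\<close> form a closed forward invariant set, so
    by minimality the preimages of \<open>B\<close> cover the space. Finitely many suffice, and all
    have mean \<open>\<mu> B\<close>.\<close>
  have open_pos: "\<mu> B > 0" if "open B" "B \<noteq> {}" for B
  proof -
    have B_open: "open ((f ^^ n) -` B)" for n
      using continuous_on_funpow[OF cont, of n] \<open>open B\<close> open_vimage by blast
    have "(\<Union>n. (f ^^ n) -` B) = UNIV"
    proof (rule ccontr)
      let ?C = "- (\<Union>n. (f ^^ n) -` B)"
      assume "(\<Union>n. (f ^^ n) -` B) \<noteq> UNIV"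
      then have "?C \<noteq> {}" by blast
      moreover have "closed ?C"
        using B_open by (auto simp: closed_def)
      moreover have "f ` ?C \<subseteq> ?C"
      proof clarsimp
        fix x n
        assume *: "\<forall>n. (f ^^ n) x \<notin> B" and "(f ^^ n) (f x) \<in> B"
        then have "(f ^^ Suc n) x \<in> B"
          by (simp add: funpow_swap1)
        with * show False by blast
      qed
      ultimately have "?C = UNIV"
        by (intro min)
      then have "x \<notin> (f ^^ 0) -` B" for x by blast
      then show False
        using \<open>B \<noteq> {}\<close> by auto
    qed
    then obtain N where N: "finite N" "(\<Union>n\<in>N. (f ^^ n) -` B) = UNIV"
      using compactE_image[OF cpt, of UNIV "\<lambda>n. (f ^^ n) -` B"] B_open by (metis subset_UNIV top.extremum_uniqueI)
    have "\<mu> ((f ^^ n) -` B) = \<mu> B" for n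
    proof (induction n)
      case (Suc n)
      have "(f ^^ Suc n) -` B = f -` ((f ^^ n) -` B)"
        by (auto simp: funpow_swap1)
      then show ?case
        using Suc invariant by metis
    qed simp
    moreover have "\<mu> (\<Union>n\<in>N. A n) \<le> (\<Sum>n\<in>N. \<mu> (A n))" for A :: "nat \<Rightarrow> 'a set"
      using N(1)
    proof (induction N rule: finite_induct)
      case (insert n N)
      then show ?case
        using modular[of "A n" "\<Union>n\<in>N. A n"] nonneg[of "A n \<inter> (\<Union>n\<in>N. A n)"] by simp
    qed (simp add: empty)
    ultimately have "\<mu> (\<Union>n\<in>N. (f ^^ n) -` B) \<le> (\<Sum>n\<in>N. \<mu> B)"
      by (metis (no_types, lifting) sum.cong)
    then have "1 \<le> real (card N) * \<mu> B"
      using N(2) total by simp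
    then show ?thesis
      using nonneg[of B] by (cases "\<mu> B = 0") auto
  qed

  \<comment> \<open>The mean is only finitely additive; outer regularisation makes it upper semicontinuous
    on closed sets and keeps it submodular.\<close>
  define outer where "outer C = Inf (\<mu> ` {G. open G \<and> C \<subseteq> G})" for C
  have outer_le: "outer C \<le> \<mu> G" if "open G" "C \<subseteq> G" for C G
    unfolding outer_def using that nonneg by (intro cInf_lower) (auto intro: bdd_belowI[of _ 0])
  have outer_ge: "t \<le> outer C" if "\<And>G. open G \<Longrightarrow> C \<subseteq> G \<Longrightarrow> t \<le> \<mu> G" for C t
    unfolding outer_def using that by (intro cInf_greatest) auto
  have outer_less: "\<exists>G. open G \<and> C \<subseteq> G \<and> \<mu> G < t" if "outer C < t" for C t
    using that outer_ge[of C t] by force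
  have outer_mono: "outer C \<le> outer D" if "C \<subseteq> D" for C D
    using that by (intro outer_ge outer_le) auto
  have outer_submodular: "outer (C \<union> D) + outer (C \<inter> D) \<le> outer C + outer D" for C D
  proof (rule field_le_epsilon)
    fix e :: real
    assume "e > 0"
    then obtain G H where "open G" "C \<subseteq> G" "\<mu> G < outer C + e / 2" "open H" "D \<subseteq> H" "\<mu> H < outer D + e / 2"
      using outer_less[of C "outer C + e / 2"] outer_less[of D "outer D + e / 2"] by auto
    then show "outer (C \<union> D) + outer (C \<inter> D) \<le> outer C + outer D + e"
      using outer_le[of "G \<union> H" "C \<union> D"] outer_le[of "G \<inter> H" "C \<inter> D"] modular[of G H] by force
  qed
  have outer_vimage: "outer (f -` C) \<le> outer C" for C
  proof (rule outer_ge)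
    fix G
    assume "open G" "C \<subseteq> G"
    then have "outer (f -` C) \<le> \<mu> (f -` G)"
      using cont by (intro outer_le open_vimage) auto
    then show "outer (f -` C) \<le> \<mu> G"
      by (simp add: invariant)
  qed

  define K where "K = {(x, y). \<forall>n. \<epsilon> \<le> dist ((f ^^ n) x) ((f ^^ n) y)}"
  have "K = (\<Inter>n. {p. \<epsilon> \<le> dist ((f ^^ n) (fst p)) ((f ^^ n) (snd p))})"
    by (auto simp: K_def)
  also have "closed \<dots>"
    by (intro closed_INT ballI closed_Collect_le continuous_intros
        continuous_on_compose2[OF continuous_on_funpow[OF cont]]) auto
  finally have K_closed: "closed K" .
  have K_step: "K `` {x} \<subseteq> f -` (K `` {f x})" for x
  proof (clarsimp simp: K_def)
    fix y n
    assume "\<forall>n. \<epsilon> \<le> dist ((f ^^ n) x) ((f ^^ n) y)"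
    then have "\<epsilon> \<le> dist ((f ^^ Suc n) x) ((f ^^ Suc n) y)" by blast
    then show "\<epsilon> \<le> dist ((f ^^ n) (f x)) ((f ^^ n) (f y))"
      by (simp add: funpow_swap1)
  qed
  note K_usc = open_section_subset[OF cpt K_closed]
  \<comment> \<open>The superlevel set \<open>?C\<close> is closed by upper semicontinuity, forward
    invariant by \<open>K_step\<close>, and contains \<open>x\<close>.\<close>
  have outer_const: "outer (K `` {x}) \<le> outer (K `` {y})" for x y
  proof -
    let ?C = "{y. outer (K `` {x}) \<le> outer (K `` {y})}"
    have "- ?C = (\<Union>G\<in>{G. open G \<and> \<mu> G < outer (K `` {x})}. {y. K `` {y} \<subseteq> G})"
    proof (intro equalityI subsetI)
      fix y
      assume "y \<in> - ?C"
      then show "y \<in> (\<Union>G\<in>{G. open G \<and> \<mu> G < outer (K `` {x})}. {y. K `` {y} \<subseteq> G})"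
        using outer_less[of "K `` {y}" "outer (K `` {x})"] by auto
    next
      fix y
      assume "y \<in> (\<Union>G\<in>{G. open G \<and> \<mu> G < outer (K `` {x})}. {y. K `` {y} \<subseteq> G})"
      then obtain G where "open G" "\<mu> G < outer (K `` {x})" "K `` {y} \<subseteq> G"
        by auto
      then show "y \<in> - ?C"
        using outer_le[of G "K `` {y}"] by auto
    qed
    also have "open \<dots>"
      using K_usc by (intro open_UN) simp
    finally have "closed ?C"
      by (simp add: closed_def)
    moreover have "outer (K `` {y}) \<le> outer (K `` {f y})" for y
      using outer_mono[OF K_step] outer_vimage by (rule order_trans)
    then have "f ` ?C \<subseteq> ?C"
      by (auto intro: order_trans)
    ultimately have "?C = UNIV"
      by (intro min) auto
    then show ?thesis by auto
  qed
  define c where "c = outer (K `` {undefined})"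
  have c: "outer (K `` {x}) = c" for x
    using outer_const unfolding c_def by (simp add: antisym)

  define \<rho> where "\<rho> x y = outer (K `` {x} \<union> K `` {y}) - c" for x y
  \<comment> \<open>The intersection \<open>?A \<inter> ?B\<close> contains the section over
    \<open>y\<close>, which has size \<open>c\<close>; submodularity does the rest.\<close>
  have tri: "\<rho> x z \<le> \<rho> x y + \<rho> y z" for x y z
  proof -
    let ?A = "K `` {x} \<union> K `` {y}" and ?B = "K `` {y} \<union> K `` {z}"
    have "outer (K `` {x} \<union> K `` {z}) \<le> outer (?A \<union> ?B)" "c \<le> outer (?A \<inter> ?B)"
      unfolding c[of y, symmetric] by (intro outer_mono; blast)+
    then show ?thesis
      using outer_submodular[of ?A ?B] by (simp add: \<rho>_def)
  qed
  have small: "\<exists>d>0. \<forall>x y. dist x y < d \<longrightarrow> \<rho> x y < e" if "e > 0" for e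
  proof -
    \<comment> \<open>A Lebesgue number of this cover works: two points in one member have both
      sections inside some \<open>G\<close> with \<open>\<mu> G < c + e\<close>.\<close>
    define \<G> where "\<G> = (\<lambda>G. {x. K `` {x} \<subseteq> G}) ` {G. open G \<and> \<mu> G < c + e}"
    have "x \<in> \<Union>\<G>" for x
      using outer_less[of "K `` {x}" "c + e"] c[of x] \<open>e > 0\<close> by (auto simp: \<G>_def)
    then have cover: "UNIV \<subseteq> \<Union>\<G>"
      by (rule subsetI)
    have opens: "\<And>T. T \<in> \<G> \<Longrightarrow> open T"
      using K_usc by (auto simp: \<G>_def)
    obtain d where "d > 0" and d: "\<And>x. x \<in> UNIV \<Longrightarrow> \<exists>T\<in>\<G>. ball x d \<subseteq> T"
      using Heine_Borel_lemma[OF cpt cover opens] by blast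
    have "\<rho> x y < e" if "dist x y < d" for x y
    proof -
      obtain G where G: "open G" "\<mu> G < c + e" "ball x d \<subseteq> {x. K `` {x} \<subseteq> G}"
        using d[OF UNIV_I, of x] by (auto simp: \<G>_def)
      moreover have "x \<in> ball x d" "y \<in> ball x d"
        using that \<open>d > 0\<close> by auto
      ultimately have "K `` {x} \<union> K `` {y} \<subseteq> G"
        by (simp only: subset_iff mem_Collect_eq Un_iff) metis
      from outer_le[OF G(1) this] show ?thesis
        using G(2) by (simp add: \<rho>_def)
    qed
    then show ?thesis
      using \<open>d > 0\<close> by blast
  qed
  have sym: "\<rho> x y = \<rho> y x" for x y
    by (simp add: \<rho>_def Un_commute)
  have \<rho>: "continuous_pseudometric \<rho>"
    unfolding continuous_pseudometric_def
    by (intro conjI allI impI sym tri small)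
  \<comment> \<open>Only expansion is visible directly; compactness then upgrades it to
    invariance.\<close>
  have "\<rho> x y \<le> \<rho> (f x) (f y)" for x y
  proof -
    have "K `` {x} \<union> K `` {y} \<subseteq> f -` (K `` {f x} \<union> K `` {f y})"
      using K_step[of x] K_step[of y] by auto
    from order_trans[OF outer_mono[OF this] outer_vimage] show ?thesis
      by (simp add: \<rho>_def)
  qed
  then have iso: "\<rho> (f x) (f y) = \<rho> x y" for x y
    using expanding_imp_isometric[OF cpt \<rho>] by blast

  obtain x y where "x \<in> U" "y \<in> V"
    using U V by blast
  \<comment> \<open>No point lies in its own section, whereas all of \<open>V\<close> lies in the
    section over \<open>x\<close>; a ball about \<open>y\<close> tells the two sections
    apart.\<close>
  have "y \<notin> K `` {y}"
    using \<open>\<epsilon> > 0\<close> by (auto simp: K_def)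
  moreover have "closed (K `` {y})"
  proof -
    have "closed ((\<lambda>z. (y, z)) -` K)"
      by (intro closed_vimage K_closed continuous_intros)
    then show ?thesis by (simp add: vimage_def Image_def)
  qed
  ultimately have "open (V - K `` {y})" "y \<in> V - K `` {y}"
    using V \<open>y \<in> V\<close> by auto
  then obtain r where "r > 0" and r: "cball y r \<subseteq> V - K `` {y}"
    using open_contains_cball by metis
  \<comment> \<open>Closed, so that \<open>G - B\<close> below is open.\<close>
  define B where "B = cball y r"
  have "\<mu> (ball y r) > 0"
    using \<open>r > 0\<close> by (intro open_pos) auto
  then have "\<mu> B > 0"
    using mono[OF ball_subset_cball[of y r]] by (simp add: B_def)
  have "B \<subseteq> K `` {x}"
    using apart[OF \<open>x \<in> U\<close>] r by (auto simp: K_def B_def)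
  have "\<mu> B + c \<le> outer (K `` {x} \<union> K `` {y})"
  proof (rule outer_ge)
    fix G
    assume G: "open G" "K `` {x} \<union> K `` {y} \<subseteq> G"
    have "c \<le> \<mu> (G - B)"
      unfolding c[of y, symmetric] using G r by (intro outer_le) (auto simp: B_def)
    moreover have "\<mu> G = \<mu> B + \<mu> (G - B)"
      using disjoint[of B "G - B"] G \<open>B \<subseteq> K `` {x}\<close> by (simp add: Un_absorb1 subset_trans)
    ultimately show "\<mu> B + c \<le> \<mu> G" by simp
  qed
  then have "\<rho> x y > 0"
    using \<open>\<mu> B > 0\<close> by (simp add: \<rho>_def)
  with \<rho> iso show ?thesis by blast
qed

section \<open>Systems with a collective limit\<close>

lemma nds_iter_add: "nds_iter F i (m + k) = nds_iter F (i + m) k \<circ> nds_iter F i m"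
  by (induction k) (simp_all add: add.assoc o_assoc)

lemma continuous_on_nds_iter:
  assumes "\<forall>i\<ge>1. continuous_on UNIV (F i)" "i \<ge> 1"
  shows "continuous_on UNIV (nds_iter F i n)"
proof (induction n)
  case (Suc n)
  have "continuous_on UNIV (F (i + n))"
    using assms by simp
  then show ?case
    using Suc by (auto intro: continuous_on_compose2[of UNIV "F (i + n)"] simp: comp_def)
qed (simp add: id_def)

lemma surj_nds_iter:
  assumes "nds_surjective F" "i \<ge> 1"
  shows "surj (nds_iter F i n)"
proof (induction n)
  case (Suc n)
  have "surj (F (i + n))"
    using assms by (simp add: nds_surjective_def)
  with Suc show ?case
    unfolding nds_iter.simps by (rule comp_surj)
qed simp

lemma interior_nds_iter:
  assumes "feeble_open F" "i \<ge> 1" "open U" "U \<noteq> {}"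
  shows "interior (nds_iter F i n ` U) \<noteq> {}"
proof (induction n)
  case 0
  then show ?case
    using assms by (simp add: interior_open)
next
  case (Suc n)
  have "interior (F (i + n) ` interior (nds_iter F i n ` U)) \<noteq> {}"
    using assms(1,2) Suc by (simp add: feeble_open_def)
  moreover have "interior (F (i + n) ` interior (nds_iter F i n ` U)) \<subseteq>
      interior (nds_iter F i (Suc n) ` U)"
    unfolding nds_iter.simps image_comp[symmetric]
    by (intro interior_mono image_mono interior_subset)
  ultimately show ?case by blast
qed

text \<open>Compactness bounds the distances, so the real supremum is a genuine upper bound.\<close>

lemma dist_le_sup_dist:
  fixes g h :: "'a \<Rightarrow> 'a::metric_space"
  assumes "compact (UNIV :: 'a set)"
  shows "dist (g x) (h x) \<le> sup_dist g h"
  unfolding sup_dist_def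
proof (rule cSUP_upper)
  show "bdd_above (range (\<lambda>x. dist (g x) (h x)))"
    using diameter_bounded_bound[OF compact_imp_bounded[OF assms]]
    by (intro bdd_aboveI[of _ "diameter (UNIV :: 'a set)"]) auto
qed simp

locale collective_nds =
  fixes F :: "nat \<Rightarrow> 'a::metric_space \<Rightarrow> 'a" and f :: "'a \<Rightarrow> 'a"
  assumes nontrivial: "\<exists>x y :: 'a. x \<noteq> y"
    and system: "nds F"
    and minimal: "nds_minimal F"
    and feeble_open: "feeble_open F"
    and surjective: "nds_surjective F"
    and collective: "converges_collectively F f"
    and multi_transitive: "multi_transitive F"
begin

lemma compact_UNIV: "compact (UNIV :: 'a set)"
  using system by (simp add: nds_def)

lemma cont_iter: "continuous_on UNIV (nds_iter F 1 n)"
  using system by (intro continuous_on_nds_iter) (auto simp: nds_def)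

text \<open>The start index \<open>1 + r\<close> is what \<open>nds_iter_add\<close> leaves after
  the first \<open>r\<close> maps. Exponent 0 is included because both iterates are then the
  identity.\<close>

lemma uniformly_near:
  assumes "e > 0"
  obtains r0 where "\<And>r k x. r \<ge> r0 \<Longrightarrow> dist (nds_iter F (1 + r) k x) ((f ^^ k) x) < e"
proof -
  obtain r0 where r0: "\<And>r k. r \<ge> r0 \<Longrightarrow> k \<ge> 1 \<Longrightarrow> sup_dist (nds_iter F r k) (f ^^ k) < e"
    using collective assms unfolding converges_collectively_def by meson
  have "dist (nds_iter F (1 + r) k x) ((f ^^ k) x) < e" if "r \<ge> r0" for r k x
  proof (cases k)
    case (Suc m)
    have "dist (nds_iter F (1 + r) k x) ((f ^^ k) x) \<le> sup_dist (nds_iter F (1 + r) k) (f ^^ k)"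
      by (rule dist_le_sup_dist[OF compact_UNIV])
    also have "\<dots> < e"
      using that Suc by (intro r0) auto
    finally show ?thesis .
  qed (simp add: assms)
  then show ?thesis by (rule that)
qed

text \<open>The case \<open>k = 1\<close> of \<open>uniformly_near\<close> exhibits \<open>f\<close>
  as a uniform limit of continuous maps.\<close>

lemma continuous_limit: "continuous_on UNIV f"
proof (rule uniform_limit_theorem)
  show "\<forall>\<^sub>F n in sequentially. continuous_on UNIV (F (Suc n))"
    using system by (simp add: nds_def)
  show "uniform_limit UNIV (\<lambda>n. F (Suc n)) f sequentially"
  proof (rule uniform_limitI)
    fix e :: real
    assume "e > 0"
    then obtain r0 where r0: "\<And>r k x. r \<ge> r0 \<Longrightarrow> dist (nds_iter F (1 + r) k x) ((f ^^ k) x) < e"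
      by (rule uniformly_near) (rule that)
    show "\<forall>\<^sub>F n in sequentially. \<forall>x\<in>UNIV. dist (F (Suc n) x) (f x) < e"
      using r0[of _ 1] by (auto simp: eventually_sequentially)
  qed
qed simp

section \<open>Recurrence and minimality of the limit map\<close>

text \<open>Multi-transitivity is applied to the preimage of a ball under the first \<open>r\<close>
  maps; everything after these maps is uniformly close to iterates of \<open>f\<close>. The shift
  \<open>r\<close> depends on \<open>e\<close> alone.\<close>

lemma joint_return:
  assumes "e > 0"
  obtains r where "\<And>p q. \<exists>a u v. dist p u < e \<and> dist p v < e \<and>
    dist p ((f ^^ a) u) < e \<and> dist q ((f ^^ (2 * a + r)) v) < e"
proof -
  obtain r where r: "\<And>r' k x. r' \<ge> r \<Longrightarrow> dist (nds_iter F (1 + r') k x) ((f ^^ k) x) < e / 2"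
    using uniformly_near[of "e / 2"] assms by auto
  have "\<exists>a u v. dist p u < e \<and> dist p v < e \<and>
      dist p ((f ^^ a) u) < e \<and> dist q ((f ^^ (2 * a + r)) v) < e" for p q
  proof -
    define W where "W = nds_iter F 1 r -` ball p e"
    have W: "open W" "W \<noteq> {}"
    proof -
      show "open W"
        unfolding W_def using cont_iter by (intro open_vimage) auto
      obtain w where "nds_iter F 1 r w = p"
        using surj_nds_iter[OF surjective, of 1 r] by (metis le_refl surjD)
      then have "w \<in> W"
        using assms by (simp add: W_def)
      then show "W \<noteq> {}" by blast
    qed
    \<comment> \<open>The indices \<open>m\<close> and \<open>2 * m\<close> instead of 1 and 2 ensure that the return time is at least \<open>r\<close>.\<close>
    define m where "m = Suc r"
    \<comment> \<open>Only the indices \<open>m\<close> and \<open>2 * m\<close> matter; every other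
      index just receives a nonempty open target.\<close>
    define V where "V j = (if j = m then ball p (e / 2) else ball q (e / 2))" for j
    have "\<exists>l\<ge>1. \<forall>j\<in>{1..2 * m}. nds_iter F 1 (j * l) ` W \<inter> V j \<noteq> {}"
      using multi_transitive[unfolded multi_transitive_def, rule_format, of "2 * m" "\<lambda>_. W" V]
        W assms by (auto simp: m_def V_def)
    then obtain l where "l \<ge> 1"
      and l: "\<And>j. j \<in> {1..2 * m} \<Longrightarrow> nds_iter F 1 (j * l) ` W \<inter> V j \<noteq> {}"
      by blast
    obtain w where w: "w \<in> W" "nds_iter F 1 (m * l) w \<in> ball p (e / 2)"
      using l[of m] by (auto simp: V_def m_def)
    obtain w' where w': "w' \<in> W" "nds_iter F 1 (2 * m * l) w' \<in> ball q (e / 2)"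
      using l[of "2 * m"] by (auto simp: V_def m_def)
    define a where "a = m * l - r"
    have "r \<le> m * l"
      using \<open>l \<ge> 1\<close> by (cases l) (auto simp: m_def)
    \<comment> \<open>Doubling \<open>r + a\<close> produces the surplus \<open>r\<close> in the
      second time.\<close>
    then have ml: "m * l = r + a" "2 * m * l = r + (2 * a + r)"
      by (auto simp: a_def)
    let ?u = "nds_iter F 1 r w" and ?v = "nds_iter F 1 r w'"
    have "dist p ?u < e" "dist p ?v < e"
      using w w' by (auto simp: W_def)
    moreover have "dist p ((f ^^ a) ?u) < e"
      using w(2) r[of r a ?u] dist_triangle_half_r[of "nds_iter F 1 (m * l) w" p e "(f ^^ a) ?u"]
      unfolding ml nds_iter_add comp_apply mem_ball by (simp add: dist_commute)
    moreover have "dist q ((f ^^ (2 * a + r)) ?v) < e"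
      using w'(2) r[of r "2 * a + r" ?v]
        dist_triangle_half_r[of "nds_iter F 1 (2 * m * l) w'" q e "(f ^^ (2 * a + r)) ?v"]
      unfolding ml nds_iter_add[of _ 1 r] comp_apply mem_ball by (simp add: dist_commute)
    ultimately show ?thesis by blast
  qed
  then show ?thesis by (rule that)
qed

text \<open>Any \<open>q\<close> is chained to the image under \<open>f ^^ r\<close> of a fixed
  \<open>p\<close> in \<open>U\<close>: apart from an arbitrarily small first link, three links each
  compare two points of \<open>U\<close> at one time, at cost \<open>s\<close>. Two such chains give
  the factor 6.\<close>

lemma oscillation_bound:
  assumes \<rho>: "continuous_pseudometric \<rho>" and U: "open U" "U \<noteq> {}"
    and s: "\<And>u v n. u \<in> U \<Longrightarrow> v \<in> U \<Longrightarrow> \<rho> ((f ^^ n) u) ((f ^^ n) v) \<le> s"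
  shows "\<rho> x y \<le> 6 * s"
proof (rule field_le_epsilon)
  fix e :: real
  assume "e > 0"
  have sym: "\<rho> a b = \<rho> b a" and tri: "\<rho> a c \<le> \<rho> a b + \<rho> b c" for a b c
    using \<rho> unfolding continuous_pseudometric_def by blast+
  obtain d where "d > 0" and d: "\<And>x y. dist x y < d \<Longrightarrow> \<rho> x y < e / 2"
    using \<rho> \<open>e > 0\<close> unfolding continuous_pseudometric_def by (metis half_gt_zero)
  obtain p where "p \<in> U"
    using U by blast
  then obtain t where "t > 0" "ball p t \<subseteq> U"
    using U open_contains_ball by blast
  have "min d t > 0"
    using \<open>d > 0\<close> \<open>t > 0\<close> by simp
  then obtain r where r: "\<And>p q. \<exists>a u v. dist p u < min d t \<and> dist p v < min d t \<and>
      dist p ((f ^^ a) u) < min d t \<and> dist q ((f ^^ (2 * a + r)) v) < min d t"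
    by (rule joint_return) (rule that)
  have "\<rho> q ((f ^^ r) p) \<le> 3 * s + e / 2" for q
  proof -
    obtain a u v where a: "dist p u < min d t" "dist p v < min d t"
      "dist p ((f ^^ a) u) < min d t" "dist q ((f ^^ (2 * a + r)) v) < min d t"
      using r by blast
    then have inU: "u \<in> U" "v \<in> U" "(f ^^ a) u \<in> U"
      using \<open>ball p t \<subseteq> U\<close> by auto
    have "\<rho> q ((f ^^ (2 * a + r)) v) < e / 2"
      using a by (intro d) simp
    moreover have "\<rho> ((f ^^ (2 * a + r)) v) ((f ^^ (2 * a + r)) u) \<le> s"
      by (intro s inU)
    moreover have "\<rho> ((f ^^ (2 * a + r)) u) ((f ^^ (a + r)) u) \<le> s"
    \<comment> \<open>Here \<open>u\<close> and its return \<open>(f ^^ a) u\<close> are compared at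
      time \<open>a + r\<close>.\<close>
    proof -
      have "2 * a + r = (a + r) + a" by simp
      then have "(f ^^ (2 * a + r)) u = (f ^^ (a + r)) ((f ^^ a) u)"
        by (simp only: funpow_add comp_apply)
      then show ?thesis
        using s[OF inU(3,1), of "a + r"] by simp
    qed
    moreover have "\<rho> ((f ^^ (a + r)) u) ((f ^^ r) p) \<le> s"
      using s[OF inU(3) \<open>p \<in> U\<close>, of r] by (simp add: add.commute[of a r] funpow_add)
    ultimately show ?thesis
      using tri[of q "(f ^^ r) p" "(f ^^ (2 * a + r)) v"]
        tri[of "(f ^^ (2 * a + r)) v" "(f ^^ r) p" "(f ^^ (2 * a + r)) u"]
        tri[of "(f ^^ (2 * a + r)) u" "(f ^^ r) p" "(f ^^ (a + r)) u"] by linarith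
  qed
  from this[of x] this[of y] show "\<rho> x y \<le> 6 * s + e"
    using tri[of x y "(f ^^ r) p"] sym[of y "(f ^^ r) p"] by linarith
qed

text \<open>A singleton has oscillation 0 at all times, so \<open>oscillation_bound\<close> would
  collapse the space to a point.\<close>

lemma not_open_singleton: "\<not> open {p :: 'a}"
proof
  assume "open {p}"
  then have "dist x y \<le> 6 * 0" for x y :: 'a
    by (rule oscillation_bound[OF continuous_pseudometric_dist]) auto
  then show False
    using nontrivial by simp
qed

text \<open>The system carries some \<open>w\<close> into \<open>C\<close> after \<open>r\<close>
  steps, and from then on the dense orbit of \<open>w\<close> shadows an orbit of \<open>f\<close>
  inside \<open>C\<close>.\<close>

lemma minimal_limit:
  assumes C: "closed C" "C \<noteq> {}" "f ` C \<subseteq> C"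
  shows "C = UNIV"
proof (rule ccontr)
  assume "C \<noteq> UNIV"
  then obtain y where "y \<in> - C" by blast
  then obtain e where "e > 0" and e: "ball y e \<subseteq> - C"
    using C(1) open_contains_ball by (metis open_Compl)
  obtain r where r: "\<And>r' k x. r' \<ge> r \<Longrightarrow> dist (nds_iter F (1 + r') k x) ((f ^^ k) x) < e / 2"
    using uniformly_near[of "e / 2"] \<open>e > 0\<close> by auto
  obtain x where "x \<in> C"
    using C(2) by blast
  obtain w where w: "nds_iter F 1 r w = x"
    using surj_nds_iter[OF surjective, of 1 r] by (metis le_refl surjD)
  let ?A = "(\<lambda>n. nds_iter F 1 n w) ` {..<r}"
  \<comment> \<open>Without isolated points, deleting the first \<open>r\<close> orbit points leaves
    a nonempty open set, so density gives a visit at a time at least \<open>r\<close>.\<close>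
  have "infinite (ball y (e / 2))"
    using not_open_singleton[of y] \<open>e > 0\<close>
    by (metis islimpt_UNIV_iff islimpt_eq_infinite_ball Int_UNIV_left half_gt_zero)
  then have "ball y (e / 2) - ?A \<noteq> {}"
    by (metis Diff_eq_empty_iff finite_imageI finite_lessThan finite_subset)
  moreover have "open (ball y (e / 2) - ?A)"
    by (intro open_Diff open_ball finite_imp_closed finite_imageI finite_lessThan)
  moreover have "closure (range (\<lambda>n. nds_iter F 1 n w)) = UNIV"
    using minimal by (simp add: nds_minimal_def)
  ultimately have "(ball y (e / 2) - ?A) \<inter> range (\<lambda>n. nds_iter F 1 n w) \<noteq> {}"
    using open_Int_closure_eq_empty[of "ball y (e / 2) - ?A" "range (\<lambda>n. nds_iter F 1 n w)"]
    by simp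
  then obtain n where n: "nds_iter F 1 n w \<in> ball y (e / 2) - ?A"
    by blast
  then have "r \<le> n"
    by (auto simp: not_less[symmetric])
  then have nr: "n = r + (n - r)" by simp
  have "nds_iter F 1 n w = nds_iter F (1 + r) (n - r) x"
    by (subst nr) (simp only: nds_iter_add comp_apply w)
  then have "dist y ((f ^^ (n - r)) x) < e"
    using n r[of r "n - r" x] dist_triangle_half_r[of "nds_iter F 1 n w" y e "(f ^^ (n - r)) x"]
    by (simp add: dist_commute)
  moreover have "(f ^^ k) x \<in> C" for k
    by (induction k) (use \<open>x \<in> C\<close> C(3) in auto)
  ultimately show False
    using e by auto
qed

section \<open>Density of proximal and of separated pairs for the system\<close>

text \<open>If this fails, the interiors of the images of \<open>U\<close> and \<open>V\<close>
  after \<open>r\<close> steps have orbits under \<open>f\<close> that stay \<open>e / 3\<close>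
  apart. The resulting invariant pseudometric contradicts \<open>oscillation_bound\<close> on a
  small ball.\<close>

lemma proximal_dense:
  assumes U: "open U" "U \<noteq> {}" and V: "open V" "V \<noteq> {}" and "e > 0"
  shows "\<exists>n\<ge>N. \<exists>u\<in>U. \<exists>v\<in>V. dist (nds_iter F 1 n u) (nds_iter F 1 n v) < e"
proof (rule ccontr)
  assume "\<not> ?thesis"
  then have apart: "e \<le> dist (nds_iter F 1 n u) (nds_iter F 1 n v)"
    if "n \<ge> N" "u \<in> U" "v \<in> V" for n u v
    using that by force
  obtain r0 where r0: "\<And>r k x. r \<ge> r0 \<Longrightarrow> dist (nds_iter F (1 + r) k x) ((f ^^ k) x) < e / 3"
    using uniformly_near[of "e / 3"] \<open>e > 0\<close> by auto
  \<comment> \<open>At least \<open>N\<close> so that \<open>apart\<close> applies, at least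
    \<open>r0\<close> for the approximation by \<open>f\<close>.\<close>
  define r where "r = max N r0"
  define U' where "U' = interior (nds_iter F 1 r ` U)"
  define V' where "V' = interior (nds_iter F 1 r ` V)"
  have "e / 3 \<le> dist ((f ^^ n) u') ((f ^^ n) v')" if u': "u' \<in> U'" and v': "v' \<in> V'" for u' v' n
  proof -
    obtain u where u: "u \<in> U" "u' = nds_iter F 1 r u"
      using u' interior_subset by (auto simp: U'_def)
    obtain v where v: "v \<in> V" "v' = nds_iter F 1 r v"
      using v' interior_subset by (auto simp: V'_def)
    have "e \<le> dist (nds_iter F (1 + r) n u') (nds_iter F (1 + r) n v')"
      using apart[of "r + n" u v] u v unfolding nds_iter_add comp_apply r_def by simp
    moreover have "dist (nds_iter F (1 + r) n u') ((f ^^ n) u') < e / 3"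
      "dist (nds_iter F (1 + r) n v') ((f ^^ n) v') < e / 3"
      by (intro r0; simp add: r_def)+
    ultimately show ?thesis
      using dist_triangle[of "nds_iter F (1 + r) n u'" "nds_iter F (1 + r) n v'" "(f ^^ n) u'"]
        dist_triangle[of "(f ^^ n) u'" "nds_iter F (1 + r) n v'" "(f ^^ n) v'"]
        dist_commute[of "nds_iter F (1 + r) n v'" "(f ^^ n) v'"] by linarith
  qed
  moreover have "open U'" "U' \<noteq> {}" "open V'" "V' \<noteq> {}"
    unfolding U'_def V'_def by (intro open_interior interior_nds_iter[OF feeble_open] U V; simp)+
  ultimately obtain \<rho> x y where \<rho>: "continuous_pseudometric \<rho>"
    and iso: "\<And>x y. \<rho> (f x) (f y) = \<rho> x y" and "\<rho> x y > 0"
    using ex_invariant_pseudometric[OF compact_UNIV continuous_limit minimal_limit, of U' V' "e / 3"] \<open>e > 0\<close>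
    by (smt (verit, best) divide_pos_pos)
  have iter: "\<rho> ((f ^^ n) u) ((f ^^ n) v) = \<rho> u v" for n u v
    by (induction n) (simp_all add: iso)
  \<comment> \<open>Twelve is twice the factor in \<open>oscillation_bound\<close>, which leaves
    \<open>\<rho> x y \<le> \<rho> x y / 2\<close>.\<close>
  obtain d where "d > 0" and d: "\<And>u v. dist u v < d \<Longrightarrow> \<rho> u v < \<rho> x y / 12"
    using \<rho> \<open>\<rho> x y > 0\<close> unfolding continuous_pseudometric_def
    by (metis zero_less_divide_iff zero_less_numeral)
  have "\<rho> x y \<le> 6 * (\<rho> x y / 12)"
  proof (rule oscillation_bound[OF \<rho>, of "ball x (d / 2)"])
    fix u v n
    assume "u \<in> ball x (d / 2)" "v \<in> ball x (d / 2)"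
    then have "dist u v < d"
      by (auto intro: dist_triangle_half_r)
    then show "\<rho> ((f ^^ n) u) ((f ^^ n) v) \<le> \<rho> x y / 12"
      unfolding iter using d by force
  qed (use \<open>d > 0\<close> in auto)
  then show False
    using \<open>\<rho> x y > 0\<close> by simp
qed

text \<open>If \<open>U\<close> and \<open>V\<close> stayed close from time \<open>N\<close> on, the
  iterates of an open set under \<open>f\<close> would remain small at all times, against
  \<open>oscillation_bound\<close>.\<close>

lemma separation_dense:
  obtains \<delta> where "\<delta> > 0"
    and "\<And>U V N. open U \<Longrightarrow> U \<noteq> {} \<Longrightarrow> open V \<Longrightarrow> V \<noteq> {} \<Longrightarrow>
      \<exists>n\<ge>N. \<exists>u\<in>U. \<exists>v\<in>V. \<delta> < dist (nds_iter F 1 n u) (nds_iter F 1 n v)"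
proof -
  obtain x y :: 'a where "x \<noteq> y"
    using nontrivial by blast
  \<comment> \<open>Any fraction below 1/24 would do: the argument bounds \<open>dist x y\<close> by
    \<open>24 * \<delta>\<close>.\<close>
  define \<delta> where "\<delta> = dist x y / 40"
  have "\<delta> > 0"
    using \<open>x \<noteq> y\<close> by (simp add: \<delta>_def)
  moreover have "\<exists>n\<ge>N. \<exists>u\<in>U. \<exists>v\<in>V. \<delta> < dist (nds_iter F 1 n u) (nds_iter F 1 n v)"
    if U: "open U" "U \<noteq> {}" and V: "open V" "V \<noteq> {}" for U V N
  proof (rule ccontr)
    assume "\<not> ?thesis"
    then have close: "dist (nds_iter F 1 n u) (nds_iter F 1 n v) \<le> \<delta>"
      if "n \<ge> N" "u \<in> U" "v \<in> V" for n u v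
      using that by force
    obtain r0 where r0: "\<And>r k x. r \<ge> r0 \<Longrightarrow> dist (nds_iter F (1 + r) k x) ((f ^^ k) x) < \<delta>"
      using uniformly_near[OF \<open>\<delta> > 0\<close>] by auto
    define r where "r = max N r0"
    define U' where "U' = interior (nds_iter F 1 r ` U)"
    \<comment> \<open>One reference point of \<open>V\<close> suffices: orbits from
      \<open>U'\<close> stay within \<open>2 * \<delta>\<close> of its orbit, hence within
      \<open>4 * \<delta>\<close> of each other.\<close>
    obtain v where "v \<in> V"
      using V by blast
    define v' where "v' = nds_iter F 1 r v"
    have *: "dist ((f ^^ n) u') (nds_iter F (1 + r) n v') \<le> 2 * \<delta>" if u': "u' \<in> U'" for u' n
    proof -
      obtain u where u: "u \<in> U" "u' = nds_iter F 1 r u"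
        using u' interior_subset by (auto simp: U'_def)
      have "dist (nds_iter F (1 + r) n u') (nds_iter F (1 + r) n v') \<le> \<delta>"
        using close[of "r + n" u v] u \<open>v \<in> V\<close> unfolding nds_iter_add comp_apply r_def v'_def by simp
      moreover have "dist (nds_iter F (1 + r) n u') ((f ^^ n) u') < \<delta>"
        by (intro r0) (simp add: r_def)
      ultimately show ?thesis
        using dist_triangle[of "(f ^^ n) u'" "nds_iter F (1 + r) n v'" "nds_iter F (1 + r) n u'"]
          dist_commute[of "nds_iter F (1 + r) n u'" "(f ^^ n) u'"] by linarith
    qed
    have "dist x y \<le> 6 * (4 * \<delta>)"
    proof (rule oscillation_bound[OF continuous_pseudometric_dist, of U'])
      show "open U'" "U' \<noteq> {}"
        unfolding U'_def by (intro open_interior interior_nds_iter[OF feeble_open] U; simp)+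
      show "dist ((f ^^ n) u) ((f ^^ n) w) \<le> 4 * \<delta>" if "u \<in> U'" "w \<in> U'" for u w n
        using *[OF that(1), of n] *[OF that(2), of n]
          dist_triangle2[of "(f ^^ n) u" "(f ^^ n) w" "nds_iter F (1 + r) n v'"] by linarith
    qed
    then show False
      using \<open>\<delta> > 0\<close> by (simp add: \<delta>_def)
  qed
  ultimately show ?thesis by (rule that)
qed

end

section \<open>Scrambled sets\<close>

text \<open>An instance of the category theorem for locally compact regular spaces; density yields a
  point because types are inhabited.\<close>

lemma Baire_compact_metric:
  fixes \<G> :: "'a::metric_space set set"
  assumes "compact (UNIV :: 'a set)" "countable \<G>"
    and "\<And>G. G \<in> \<G> \<Longrightarrow> open G"
    and "\<And>G W. G \<in> \<G> \<Longrightarrow> open W \<Longrightarrow> W \<noteq> {} \<Longrightarrow> W \<inter> G \<noteq> {}"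
  shows "\<Inter>\<G> \<noteq> {}"
proof -
  have "closure G = UNIV" if "G \<in> \<G>" for G
    using assms(4)[OF that, of "- closure G"] closure_subset[of G] by (auto simp: disjoint_eq_subset_Compl)
  moreover have "compact_space (euclidean :: 'a topology)"
    using assms(1) by (simp add: compact_space_def)
  then have "locally_compact_space (euclidean :: 'a topology)"
    using compact_imp_locally_compact_space by blast
  moreover have "regular_space (euclidean :: 'a topology)"
    by (simp add: metrizable_imp_regular_space metrizable_space_euclidean)
  ultimately have "euclidean closure_of \<Inter>\<G> = topspace euclidean"
    using assms(2,3) by (intro Baire_category) auto
  then show ?thesis by auto
qed

text \<open>Total boundedness supplies finite nets at every scale \<open>1 / Suc k\<close>; the
  balls of that radius about their points form a pi-base.\<close>

lemma ex_countable_pseudobase: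
  assumes "compact (UNIV :: 'a::metric_space set)"
  obtains \<B> :: "'a::metric_space set set" where "countable \<B>" "\<And>B. B \<in> \<B> \<Longrightarrow> open B" "\<And>B. B \<in> \<B> \<Longrightarrow> B \<noteq> {}"
    "\<And>W. open W \<Longrightarrow> W \<noteq> {} \<Longrightarrow> \<exists>B\<in>\<B>. B \<subseteq> W"
proof -
  have "\<exists>T. finite T \<and> (UNIV :: 'a set) \<subseteq> (\<Union>x\<in>T. ball x (1 / Suc k))" for k
    using assms[unfolded compact_eq_totally_bounded] by simp
  then obtain T :: "nat \<Rightarrow> 'a set"
    where T: "\<And>k. finite (T k)" "\<And>k. UNIV \<subseteq> (\<Union>x\<in>T k. ball x (1 / Suc k))"
    by metis
  define \<B> where "\<B> = (\<Union>k. (\<lambda>x. ball x (1 / Suc k)) ` T k)"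
  show ?thesis
  proof (rule that)
    show "countable \<B>"
      unfolding \<B>_def using T(1) by (intro countable_UN countable_image) (auto intro: countable_finite)
    show "open B" "B \<noteq> {}" if "B \<in> \<B>" for B
      using that by (auto simp: \<B>_def)
    show "\<exists>B\<in>\<B>. B \<subseteq> W" if W: "open W" "W \<noteq> {}" for W
    proof -
      obtain y e where "e > 0" and e: "ball y e \<subseteq> W"
        using W open_contains_ball by blast
      obtain k where k: "1 / Suc k < e / 2"
        using nat_approx_posE[of "e / 2"] \<open>e > 0\<close> by auto
      obtain x where "x \<in> T k" "y \<in> ball x (1 / Suc k)"
        using T(2)[of k] by blast
      then have "ball x (1 / Suc k) \<subseteq> ball y e"
        using k dist_triangle_half_r[of x y e] by fastforce
      with \<open>x \<in> T k\<close> e show ?thesis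
        by (auto simp: \<B>_def)
    qed
  qed
qed

text \<open>A weak form of Mycielski's theorem, with an uncountable set in place of a Cantor set: if
  a maximal scrambled set were countable, a Baire generic point would extend it.\<close>

lemma ex_uncountable_scrambled:
  fixes \<R> :: "('a::metric_space \<times> 'a) set set"
  assumes cpt: "compact (UNIV :: 'a set)" and "countable \<R>"
    and R_open: "\<And>R. R \<in> \<R> \<Longrightarrow> open R"
    and dense: "\<And>R U V. R \<in> \<R> \<Longrightarrow> open U \<Longrightarrow> U \<noteq> {} \<Longrightarrow> open V \<Longrightarrow> V \<noteq> {} \<Longrightarrow> U \<times> V \<inter> R \<noteq> {}"
    and sym: "\<And>x y. (x, y) \<in> \<Inter>\<R> \<Longrightarrow> (y, x) \<in> \<Inter>\<R>"
    and irrefl: "\<And>x. (x, x) \<notin> \<Inter>\<R>"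
  shows "\<exists>S. uncountable S \<and> (\<forall>x\<in>S. \<forall>y\<in>S. x \<noteq> y \<longrightarrow> (x, y) \<in> \<Inter>\<R>)"
proof -
  obtain \<B> :: "'a set set" where \<B>: "countable \<B>" "\<And>B. B \<in> \<B> \<Longrightarrow> open B" "\<And>B. B \<in> \<B> \<Longrightarrow> B \<noteq> {}"
    and base: "\<And>W. open W \<Longrightarrow> W \<noteq> {} \<Longrightarrow> \<exists>B\<in>\<B>. B \<subseteq> W"
    using ex_countable_pseudobase[OF cpt] by blast
  have section_open: "open {x. (x, v) \<in> R}" "open {v. (x, v) \<in> R}" if "R \<in> \<R>" for R x v
  proof -
    have "open ((\<lambda>x. (x, v)) -` R)" "open (Pair x -` R)"
      using R_open[OF that] by (intro open_vimage continuous_intros; simp)+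
    then show "open {x. (x, v) \<in> R}" "open {v. (x, v) \<in> R}"
      by (simp_all add: vimage_def)
  qed
  \<comment> \<open>A point in all the sets \<open>E R B\<close> has only dense sections (Kuratowski-Ulam), and a maximal
    scrambled set of such points cannot be countable.\<close>
  define E where "E R B = {x. \<exists>v\<in>B. (x, v) \<in> R}" for R :: "('a \<times> 'a) set" and B
  define \<E> where "\<E> = (\<lambda>(R, B). E R B) ` (\<R> \<times> \<B>)"
  have \<E>_countable: "countable \<E>"
    unfolding \<E>_def using \<open>countable \<R>\<close> \<B>(1) by simp
  have \<E>_open: "open G" if G: "G \<in> \<E>" for G
  proof -
    obtain R B where "R \<in> \<R>" "G = E R B"
      using G by (auto simp: \<E>_def)
    moreover have "E R B = (\<Union>v\<in>B. {x. (x, v) \<in> R})"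
      by (auto simp: E_def)
    ultimately show ?thesis
      using section_open(1) by auto
  qed
  have \<E>_dense: "W \<inter> G \<noteq> {}" if G: "G \<in> \<E>" and W: "open W" "W \<noteq> {}" for G W
  proof -
    obtain R B where RB: "R \<in> \<R>" "B \<in> \<B>" "G = E R B"
      using G by (auto simp: \<E>_def)
    have "W \<times> B \<inter> R \<noteq> {}"
      using RB W dense[of R W B] \<B>(2,3)[of B] by blast
    then show ?thesis
      by (auto simp: RB(3) E_def)
  qed
  define P where "P = {S. S \<subseteq> \<Inter>\<E> \<and> (\<forall>x\<in>S. \<forall>y\<in>S. x \<noteq> y \<longrightarrow> (x, y) \<in> \<Inter>\<R>)}"
  have "\<exists>S\<in>P. \<forall>S'\<in>P. S \<subseteq> S' \<longrightarrow> S' = S"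
  proof (rule subset_Zorn')
    fix \<C>
    assume "subset.chain P \<C>"
    then have sub: "\<C> \<subseteq> P" and chain: "\<And>A B. A \<in> \<C> \<Longrightarrow> B \<in> \<C> \<Longrightarrow> A \<subseteq> B \<or> B \<subseteq> A"
      by (auto simp: subset_chain_def)
    have "(x, y) \<in> \<Inter>\<R>" if x: "x \<in> \<Union>\<C>" and y: "y \<in> \<Union>\<C>" and "x \<noteq> y" for x y
    proof -
      obtain A B where "A \<in> \<C>" "x \<in> A" "B \<in> \<C>" "y \<in> B"
        using x y by blast
      then obtain D where "D \<in> \<C>" "x \<in> D" "y \<in> D"
        using chain[of A B] by blast
      then have "D \<in> P"
        using sub by blast
      then show ?thesis
        using \<open>x \<in> D\<close> \<open>y \<in> D\<close> \<open>x \<noteq> y\<close> unfolding P_def by simp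
    qed
    moreover have "\<Union>\<C> \<subseteq> \<Inter>\<E>"
      using sub by (intro Union_least) (auto simp: P_def)
    ultimately show "\<Union>\<C> \<in> P"
      unfolding P_def by blast
  qed
  then obtain S where S: "S \<in> P" and S_max: "\<And>S'. S' \<in> P \<Longrightarrow> S \<subseteq> S' \<Longrightarrow> S' = S"
    by blast
  have "uncountable S"
  proof
    assume "countable S"
    \<comment> \<open>The sections over points of \<open>S\<close>; they are dense because
      \<open>S\<close> lies in every \<open>E R B\<close>.\<close>
    define \<F> where "\<F> = (\<lambda>(x, R). {v. (x, v) \<in> R}) ` (S \<times> \<R>)"
    have "\<Inter>(\<E> \<union> \<F>) \<noteq> {}"
    proof (rule Baire_compact_metric[OF cpt])
      show "countable (\<E> \<union> \<F>)"
        using \<E>_countable \<open>countable S\<close> \<open>countable \<R>\<close> by (simp add: \<F>_def)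
      show "open G" if "G \<in> \<E> \<union> \<F>" for G
        using that \<E>_open section_open(2) by (auto simp: \<F>_def)
      show "W \<inter> G \<noteq> {}" if G: "G \<in> \<E> \<union> \<F>" and W: "open W" "W \<noteq> {}" for G W
        using G
      proof
        assume "G \<in> \<F>"
        then obtain x R where x: "x \<in> S" "R \<in> \<R>" "G = {v. (x, v) \<in> R}"
          by (auto simp: \<F>_def)
        obtain B where "B \<in> \<B>" "B \<subseteq> W"
          using base[OF W] by blast
        then have "x \<in> E R B"
          using S x unfolding P_def \<E>_def by auto
        then show ?thesis
          using \<open>B \<subseteq> W\<close> by (auto simp: x(3) E_def)
      qed (use \<E>_dense W in auto)
    qed
    then obtain z where z: "z \<in> \<Inter>\<E>" "z \<in> \<Inter>\<F>"
      by blast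
    have zS: "(x, z) \<in> \<Inter>\<R>" if "x \<in> S" for x
      using z(2) that by (auto simp: \<F>_def)
    then have "insert z S \<in> P"
      using S z(1) sym unfolding P_def by simp
    \<comment> \<open>Maximality forces \<open>z\<close> into \<open>S\<close>, so \<open>z\<close>
      is related to itself, against \<open>irrefl\<close>.\<close>
    then have "z \<in> S"
      using S_max[of "insert z S"] by blast
    then show False
      using zS irrefl by blast
  qed
  then show ?thesis
    using S unfolding P_def by (intro exI[of _ S]) simp
qed

text \<open>The hypothesis \<open>nontrivial\<close> excludes the one-point space, which satisfies
  all the others but has no uncountable subset.\<close>

theorem theorem4:
  fixes F :: "nat \<Rightarrow> 'a::metric_space \<Rightarrow> 'a" and f :: "'a \<Rightarrow> 'a"
  assumes nontrivial: "\<exists>x y :: 'a. x \<noteq> y"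
    and system: "nds F"
    and minimal: "nds_minimal F"
    and feeble_open: "feeble_open F"
    and surjective: "nds_surjective F"
    and uniform: "converges_uniformly F f"
    and collective: "converges_collectively F f"
    and multi_transitive: "multi_transitive F"
  shows "li_yorke_chaotic F"
proof -
  interpret collective_nds F f
    using assms by unfold_locales
  obtain \<delta> where "\<delta> > 0"
    and separated: "\<And>U V N. open U \<Longrightarrow> U \<noteq> {} \<Longrightarrow> open V \<Longrightarrow> V \<noteq> {} \<Longrightarrow>
      \<exists>n\<ge>N. \<exists>u\<in>U. \<exists>v\<in>V. \<delta> < dist (nds_iter F 1 n u) (nds_iter F 1 n v)"
    using separation_dense by blast
  define d where "d n x y = dist (nds_iter F 1 n x) (nds_iter F 1 n y)" for n x y
  have d_sym: "d n x y = d n y x" for n x y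
    by (simp add: d_def dist_commute)
  \<comment> \<open>\<open>N\<close> bounds the time from below and sets the tolerance at once, so a
    single index expresses that the distance gets arbitrarily small at arbitrarily late
    times.\<close>
  define P where "P N = (\<Union>n\<in>{N..}. {p. d n (fst p) (snd p) < 1 / Suc N})" for N
  define Q where "Q N = (\<Union>n\<in>{N..}. {p. \<delta> < d n (fst p) (snd p)})" for N
  define \<R> where "\<R> = range P \<union> range Q"
  have cont: "continuous_on UNIV (\<lambda>p. d n (fst p) (snd p))" for n
    unfolding d_def by (intro continuous_intros continuous_on_compose2[OF cont_iter]) auto
  have "\<Inter>\<R> = (\<Inter>N. P N) \<inter> (\<Inter>N. Q N)"
    by (simp add: \<R>_def Inter_Un_distrib)
  then have mem_\<R>: "(x, y) \<in> \<Inter>\<R> \<longleftrightarrow>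
      (\<forall>N. \<exists>n\<ge>N. d n x y < 1 / Suc N) \<and> (\<forall>N. \<exists>n\<ge>N. \<delta> < d n x y)" for x y
    by (simp add: P_def Q_def Bex_def)
  have "\<exists>S. uncountable S \<and> (\<forall>x\<in>S. \<forall>y\<in>S. x \<noteq> y \<longrightarrow> (x, y) \<in> \<Inter>\<R>)"
  proof (rule ex_uncountable_scrambled[OF compact_UNIV])
    show "countable \<R>"
      by (simp add: \<R>_def)
    show "open R" if "R \<in> \<R>" for R
      using that unfolding \<R>_def P_def Q_def
      by (auto intro!: open_UN open_Collect_less continuous_on_const cont)
    show "U \<times> V \<inter> R \<noteq> {}"
      if R: "R \<in> \<R>" and UV: "open U" "U \<noteq> {}" "open V" "V \<noteq> {}" for R U V
    proof -
      have "U \<times> V \<inter> P N \<noteq> {}" for N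
      proof -
        obtain n u v where "n \<ge> N" "u \<in> U" "v \<in> V" "d n u v < 1 / Suc N"
          using proximal_dense[OF UV, of "1 / Suc N" N] by (auto simp: d_def)
        then have "(u, v) \<in> U \<times> V \<inter> P N"
          by (auto simp: P_def)
        then show ?thesis by blast
      qed
      moreover have "U \<times> V \<inter> Q N \<noteq> {}" for N
      proof -
        obtain n u v where "n \<ge> N" "u \<in> U" "v \<in> V" "\<delta> < d n u v"
          using separated[OF UV, of N] by (auto simp: d_def)
        then have "(u, v) \<in> U \<times> V \<inter> Q N"
          by (auto simp: Q_def)
        then show ?thesis by blast
      qed
      ultimately show ?thesis
        using R by (auto simp: \<R>_def)
    qed
    show "(y, x) \<in> \<Inter>\<R>" if "(x, y) \<in> \<Inter>\<R>" for x y
      using that unfolding mem_\<R> d_sym[of _ y x] .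
    show "(x, x) \<notin> \<Inter>\<R>" for x
      unfolding mem_\<R> using \<open>\<delta> > 0\<close> by (simp add: d_def)
  qed
  then obtain S where "uncountable S" and S: "\<forall>x\<in>S. \<forall>y\<in>S. x \<noteq> y \<longrightarrow> (x, y) \<in> \<Inter>\<R>"
    by (elim exE conjE) (rule that)
  have "liminf (\<lambda>n. ereal (d n x y)) = 0 \<and> limsup (\<lambda>n. ereal (d n x y)) > 0"
    if "x \<in> S" "y \<in> S" "x \<noteq> y" for x y
  proof
    have near: "\<exists>n\<ge>N. d n x y < 1 / Suc N" and far: "\<exists>n\<ge>N. \<delta> < d n x y" for N
      using S[rule_format, OF that, unfolded mem_\<R>] by simp_all
    show "liminf (\<lambda>n. ereal (d n x y)) = 0"
    proof (rule antisym)
      show "0 \<le> liminf (\<lambda>n. ereal (d n x y))"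
        by (intro Liminf_bounded always_eventually) (simp add: d_def)
      show "liminf (\<lambda>n. ereal (d n x y)) \<le> 0"
      proof (rule ccontr)
        assume "\<not> ?thesis"
        then obtain e where "ereal 0 < ereal e" and e: "ereal e < liminf (\<lambda>n. ereal (d n x y))"
          using ereal_dense2[of 0 "liminf (\<lambda>n. ereal (d n x y))"] by (auto simp: not_le zero_ereal_def)
        then obtain k where k: "1 / Suc k < e"
          using nat_approx_posE[of e] by auto
        from less_LiminfD[OF e] obtain M where M: "\<And>n. n \<ge> M \<Longrightarrow> e < d n x y"
          by (auto simp: eventually_sequentially)
        \<comment> \<open>With \<open>max M k\<close> the time is late enough for \<open>M\<close>
          and the tolerance is below \<open>e\<close>.\<close>
        obtain n where n: "n \<ge> max M k" "d n x y < 1 / Suc (max M k)"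
          using near by blast
        have "1 / real (Suc (max M k)) \<le> 1 / Suc k"
          by (simp add: frac_le)
        with M[of n] n k show False by simp
      qed
    qed
    have "ereal \<delta> \<le> limsup (\<lambda>n. ereal (d n x y))"
    proof (rule ccontr)
      assume "\<not> ?thesis"
      then have "\<forall>\<^sub>F n in sequentially. ereal (d n x y) < ereal \<delta>"
        by (intro Limsup_lessD) simp
      then obtain M where "\<And>n. n \<ge> M \<Longrightarrow> d n x y < \<delta>"
        by (auto simp: eventually_sequentially)
      with far[of M] show False by force
    qed
    moreover have "0 < ereal \<delta>"
      using \<open>\<delta> > 0\<close> by simp
    ultimately show "limsup (\<lambda>n. ereal (d n x y)) > 0"
      by (rule less_le_trans[rotated])
  qed
  then show ?thesis
    unfolding li_yorke_chaotic_def d_def using \<open>uncountable S\<close> by (intro exI[of _ S]) simp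
qed

end
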